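(* Let $\mathrm{P}_{\boldsymbol\theta}$ be the binary pairwise Markov network on $\{0,1\}^p$ with parameter $\boldsymbol\theta$, and let $\boldsymbol\theta$, $q$, and an arbitrary $\tilde{\mathbf x}_0\in\{0,1\}^p$ be given. Let $m$ be the dimension of $\boldsymbol\theta$ and let $\lVert\boldsymbol\delta(\boldsymbol\theta)\rVert_2$ be the magnitude of the gradient approximation error obtained by running $q$ trials of Gibbs-$\tau$ initialized by $\tilde{\mathbf x}_0$. Compute the matrix $\mathbf B$ from $\boldsymbol\theta$ as in the context, and choose $\epsilon_j>0$ for $j\in\{1,2,\dots,m\}$. Then, with probability at least $1-2\sum_{j=1}^m\beta_j$, where $\beta_j>0$, $j\in\{1,2,\dots,m\}$, $$\lVert\boldsymbol\delta(\boldsymbol\theta)\rVert_2\le 2\sqrt{m}\left(\mathscr G(\mathbf B^\tau)+\sqrt{\frac{\sum_{j=1}^m\epsilon_j^2}{4m}}\right),$$ with $\beta_j$ satisfying $$\epsilon_j=2\left(\sqrt{\frac{V_{\psi_j}\ln (2/\beta_j)}{2q}}+\frac{7\ln(2/\beta_j)}{3(q-1)}\right).$$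
   Context: Binary pairwise Markov network: for $\mathbf x\in\{0,1\}^p$ and $\boldsymbol\theta=(\theta_{ij})_{1\le i\le j\le p}\in\mathbb{R}^m$, $$\mathrm{P}_{\boldsymbol\theta}(\mathbf x)=\frac{1}{Z(\boldsymbol\theta)}\exp\Big(\sum_{i=1}^p\sum_{j\ge i}\theta_{ij}x_ix_j\Big),$$ with $Z(\boldsymbol\theta)$ the normalizing constant. The sufficient statistics are $\boldsymbol\psi(\mathbf x)=(x_ix_j)_{i\le j}\in\{0,1\}^m$; $\psi_j$ denotes the $j$-th component. $\mathbb{E}_{\boldsymbol\theta}\boldsymbol\psi=\sum_{\mathbf x}\mathrm{P}_{\boldsymbol\theta}(\mathbf x)\boldsymbol\psi(\mathbf x)$. Gibbs sampling: one step (Gibbs-1) takes a current state $\mathbf x\in\{0,1\}^p$ and, for $i=1,2,\dots,p$ in this order, replaces $x_i$ by a fresh draw from the conditional distribution $\mathrm{P}_{\boldsymbol\theta}(X_i\mid \mathbf x_{-i})$ given the current values of the other coordinates. Gibbs-$\tau$ applies Gibbs-1 $\tau$ times. Running $q$ independent trials from $\tilde{\mathbf x}_0$ gives samples $\tilde{\mathbf x}_\tau^{(1)},\dots,\tilde{\mathbf x}_\tau^{(q)}$. Gradient approximation error: for a data set $\mathbb{X}$ of $n$ points, $f(\boldsymbol\theta)=-\frac1n\sum_{\mathbf x\in\mathbb X}\boldsymbol\theta^\top\boldsymbol\psi(\mathbf x)+\log Z(\boldsymbol\theta)$, with gradient $\nabla f(\boldsymbol\theta)=\mathbb{E}_{\boldsymbol\theta}\boldsymbol\psi-\frac1n\sum_{\mathbf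 x\in\mathbb X}\boldsymbol\psi(\mathbf x)$; the approximate gradient is $\boldsymbol\Delta f(\boldsymbol\theta)=\frac1q\sum_{i=1}^q\boldsymbol\psi(\tilde{\mathbf x}^{(i)}_\tau)-\frac1n\sum_{\mathbf x\in\mathbb X}\boldsymbol\psi(\mathbf x)$, and $\boldsymbol\delta(\boldsymbol\theta)=\boldsymbol\Delta f(\boldsymbol\theta)-\nabla f(\boldsymbol\theta)$. $V_{\psi_j}$ is the sample variance of $\psi_j(\tilde{\mathbf x}_\tau^{(1)}),\dots,\psi_j(\tilde{\mathbf x}_\tau^{(q)})$. Matrix $\mathbf B$: put $\xi_{ij}=\theta_{\min\{i,j\},\max\{i,j\}}$ and let $\mathbf U$ be the $p\times p$ matrix with $$U_{ij}=\frac{|\exp(-\xi_{ij})-1|\,b^*}{(1+b^*\exp(-\xi_{ij}))(1+b^* )},\qquad b^*=\max\{r,\min\{s,\exp(\xi_{ij}/2)\}\},$$ $$s=\exp\Big(-\xi_{ii}-\sum_{k\ne i,\,k\ne j}\xi_{ik}\max\{-\mathrm{sgn}(\xi_{ik}),0\}\Big),\quad r=\exp\Big(-\xi_{ii}-\sum_{k\ne i,\,k\ne j}\xi_{ik}\max\{\mathrm{sgn}(\xi_{ik}),0\}\Big)$$ (so $r,s,b^*$ depend on $i,j$). Let $\mathbf B_i$ be the $p\times p$ identity matrix with its $i$-th row replaced by the $i$-th row of $\mathbf U$, and $\mathbf B=\mathbf B_p\mathbf B_{p-1}\cdots\mathbf B_1$. $\mathbf B^\tau$ is its $\tau$-th power.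 For a $p\times p$ matrix $\mathbf M$, $\mathscr G(\mathbf M)=\sum_{i=1}^p\sum_{j=1}^pM_{ij}$.
   Formalization: Since V is random, so is β_j (or ε_j); as written the probability bound is ill-defined and fails for some realised β_j. Proved instead: for all fixed b_j>0, with probability at least 1-2Σb_j, the bound holds whenever all β_j≤b_j (β_j fixed, ε_j from V included); q≥2. *)

theory Defs
  imports "HOL-Probability.Probability" "Jordan_Normal_Form.Matrix"
begin

(* Coordinates are numbered 0, ..., p - 1.  The parameter vector and the sufficient statistics
   are indexed by the pairs (i, j) with i \<le> j < p; values outside param_index p are never used. *)

type_synonym state = "nat \<Rightarrow> real"
type_synonym params = "nat \<times> nat \<Rightarrow> real"

definition states :: "nat \<Rightarrow> state set" where
  "states p = {..<p} \<rightarrow>\<^sub>E {0, 1}"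

definition param_index :: "nat \<Rightarrow> (nat \<times> nat) set" where
  "param_index p = (SIGMA i:{..<p}. {i..<p})"

definition num_params :: "nat \<Rightarrow> nat" where
  "num_params p = card (param_index p)"

definition psi :: "nat \<times> nat \<Rightarrow> state \<Rightarrow> real" where
  "psi e x = x (fst e) * x (snd e)"

subsection \<open>Binary pairwise Markov network\<close>

definition weight :: "nat \<Rightarrow> params \<Rightarrow> state \<Rightarrow> real" where
  "weight p \<theta> x = exp (\<Sum>i<p. \<Sum>j=i..<p. \<theta> (i, j) * x i * x j)"

definition partition_fun :: "nat \<Rightarrow> params \<Rightarrow> real" where
  "partition_fun p \<theta> = (\<Sum>x\<in>states p. weight p \<theta> x)"

definition network :: "nat \<Rightarrow> params \<Rightarrow> state pmf" where
  "network p \<theta> =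
     embed_pmf (\<lambda>x. if x \<in> states p then weight p \<theta> x / partition_fun p \<theta> else 0)"

subsection \<open>Gibbs sampling\<close>

text \<open>The event conditioned on is that all coordinates other than \<open>i\<close> agree with \<open>x\<close>.\<close>

definition conditional :: "nat \<Rightarrow> params \<Rightarrow> nat \<Rightarrow> state \<Rightarrow> real pmf" where
  "conditional p \<theta> i x =
     map_pmf (\<lambda>y. y i) (cond_pmf (network p \<theta>) {y. \<forall>k. k \<noteq> i \<longrightarrow> y k = x k})"

definition gibbs_update :: "nat \<Rightarrow> params \<Rightarrow> nat \<Rightarrow> state \<Rightarrow> state pmf" where
  "gibbs_update p \<theta> i x = map_pmf (\<lambda>v. x(i := v)) (conditional p \<theta> i x)"

definition gibbs1 :: "nat \<Rightarrow> params \<Rightarrow> state \<Rightarrow> state pmf" where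
  "gibbs1 p \<theta> x = foldl (\<lambda>M i. bind_pmf M (gibbs_update p \<theta> i)) (return_pmf x) [0..<p]"

definition gibbs :: "nat \<Rightarrow> params \<Rightarrow> nat \<Rightarrow> state \<Rightarrow> state pmf" where
  "gibbs p \<theta> \<tau> x = ((\<lambda>M. bind_pmf M (gibbs1 p \<theta>)) ^^ \<tau>) (return_pmf x)"

text \<open>The joint law of \<open>q\<close> independent runs; an outcome \<open>xs\<close> has the final state of run \<open>k < q\<close>
  as \<open>xs k\<close> (the value at \<open>k \<ge> q\<close> is a dummy).\<close>

definition gibbs_trials :: "nat \<Rightarrow> params \<Rightarrow> nat \<Rightarrow> nat \<Rightarrow> state \<Rightarrow> (nat \<Rightarrow> state) pmf" where
  "gibbs_trials p \<theta> q \<tau> x = Pi_pmf {..<q} (\<lambda>_. 0) (\<lambda>_. gibbs p \<theta> \<tau> x)"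

subsection \<open>Gradient approximation error\<close>

definition data_mean :: "state list \<Rightarrow> nat \<times> nat \<Rightarrow> real" where
  "data_mean X e = (\<Sum>x\<leftarrow>X. psi e x) / real (length X)"

definition objective :: "nat \<Rightarrow> state list \<Rightarrow> params \<Rightarrow> real" where
  "objective p X \<theta> =
     - (\<Sum>x\<leftarrow>X. \<Sum>e\<in>param_index p. \<theta> e * psi e x) / real (length X) + ln (partition_fun p \<theta>)"

text \<open>Partial derivative of the objective with respect to the parameter \<open>e\<close>; its closed form is
  \<open>grad_eq\<close> below.\<close>

definition grad :: "nat \<Rightarrow> state list \<Rightarrow> params \<Rightarrow> nat \<times> nat \<Rightarrow> real" where
  "grad p X \<theta> e = deriv (\<lambda>t. objective p X (\<theta>(e := t))) (\<theta> e)"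

definition sample_mean :: "nat \<Rightarrow> (nat \<Rightarrow> state) \<Rightarrow> nat \<times> nat \<Rightarrow> real" where
  "sample_mean q xs e = (\<Sum>k<q. psi e (xs k)) / real q"

definition approx_grad :: "nat \<Rightarrow> state list \<Rightarrow> (nat \<Rightarrow> state) \<Rightarrow> nat \<times> nat \<Rightarrow> real" where
  "approx_grad q X xs e = sample_mean q xs e - data_mean X e"

definition grad_error ::
    "nat \<Rightarrow> nat \<Rightarrow> state list \<Rightarrow> params \<Rightarrow> (nat \<Rightarrow> state) \<Rightarrow> nat \<times> nat \<Rightarrow> real" where
  "grad_error p q X \<theta> xs e = approx_grad q X xs e - grad p X \<theta> e"

text \<open>Unbiased normalisation, as in the empirical Bernstein inequality of Maurer and Pontil.\<close>

definition sample_var :: "nat \<Rightarrow> (nat \<Rightarrow> state) \<Rightarrow> nat \<times> nat \<Rightarrow> real" where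
  "sample_var q xs e = (\<Sum>k<q. (psi e (xs k) - sample_mean q xs e)\<^sup>2) / (real q - 1)"

subsection \<open>The matrix \<open>B\<close>\<close>

definition xi :: "params \<Rightarrow> nat \<Rightarrow> nat \<Rightarrow> real" where
  "xi \<theta> i j = \<theta> (min i j, max i j)"

definition s_bound :: "nat \<Rightarrow> params \<Rightarrow> nat \<Rightarrow> nat \<Rightarrow> real" where
  "s_bound p \<theta> i j =
     exp (- xi \<theta> i i - (\<Sum>k\<in>{..<p} - {i, j}. xi \<theta> i k * max (- sgn (xi \<theta> i k)) 0))"

definition r_bound :: "nat \<Rightarrow> params \<Rightarrow> nat \<Rightarrow> nat \<Rightarrow> real" where
  "r_bound p \<theta> i j =
     exp (- xi \<theta> i i - (\<Sum>k\<in>{..<p} - {i, j}. xi \<theta> i k * max (sgn (xi \<theta> i k)) 0))"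

definition b_star :: "nat \<Rightarrow> params \<Rightarrow> nat \<Rightarrow> nat \<Rightarrow> real" where
  "b_star p \<theta> i j = max (r_bound p \<theta> i j) (min (s_bound p \<theta> i j) (exp (xi \<theta> i j / 2)))"

text \<open>The same formula is used on the diagonal; the entries \<open>i = j\<close> are not set to zero.\<close>

definition U_mat :: "nat \<Rightarrow> params \<Rightarrow> real mat" where
  "U_mat p \<theta> = mat p p (\<lambda>(i, j).
     \<bar>exp (- xi \<theta> i j) - 1\<bar> * b_star p \<theta> i j /
       ((1 + b_star p \<theta> i j * exp (- xi \<theta> i j)) * (1 + b_star p \<theta> i j)))"

definition B_row :: "nat \<Rightarrow> params \<Rightarrow> nat \<Rightarrow> real mat" where
  "B_row p \<theta> i = mat p p (\<lambda>(k, l). if k = i then U_mat p \<theta> $$ (i, l) else 1\<^sub>m p $$ (k, l))"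

text \<open>Later factors are multiplied on the left: \<open>B\<^sub>p * \<dots> * B\<^sub>1\<close> in one-based numbering.\<close>

definition B_mat :: "nat \<Rightarrow> params \<Rightarrow> real mat" where
  "B_mat p \<theta> = foldl (\<lambda>M i. B_row p \<theta> i * M) (1\<^sub>m p) [0..<p]"

definition entry_sum :: "real mat \<Rightarrow> real" where
  "entry_sum M = (\<Sum>i<dim_row M. \<Sum>j<dim_col M. M $$ (i, j))"

subsection \<open>Basic facts\<close>

lemma finite_states [simp]: "finite (states p)"
  unfolding states_def by (intro finite_PiE) auto

lemma states_nonempty: "states p \<noteq> {}"
  unfolding states_def by (auto simp: PiE_eq_empty_iff)

lemma finite_param_index [simp]: "finite (param_index p)"
  unfolding param_index_def by auto

lemma num_params_eq: "num_params p = p * (p + 1) div 2"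
proof -
  have "num_params p = (\<Sum>i<p. p - i)"
    by (simp add: num_params_def param_index_def)
  also have "\<dots> = p * (p + 1) div 2"
    by (induction p) (auto simp: sum.lessThan_Suc_shift simp del: sum.lessThan_Suc)
  finally show ?thesis .
qed

lemma weight_pos: "weight p \<theta> x > 0"
  unfolding weight_def by simp

lemma partition_fun_pos: "partition_fun p \<theta> > 0"
  unfolding partition_fun_def by (intro sum_pos) (auto simp: weight_pos states_nonempty)

lemma weight_eq: "weight p \<theta> x = exp (\<Sum>e\<in>param_index p. \<theta> e * psi e x)"
  unfolding weight_def param_index_def psi_def
  by (subst sum.Sigma) (auto simp: case_prod_unfold algebra_simps)

lemma pmf_network:
  "pmf (network p \<theta>) x = (if x \<in> states p then weight p \<theta> x / partition_fun p \<theta> else 0)"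
proof -
  let ?f = "\<lambda>x. if x \<in> states p then weight p \<theta> x / partition_fun p \<theta> else 0"
  have nn: "?f x \<ge> 0" for x
    using weight_pos[of p \<theta> x] partition_fun_pos[of p \<theta>]
    by (auto intro!: divide_nonneg_pos less_imp_le[OF weight_pos])
  have "(\<integral>\<^sup>+x. ennreal (?f x) \<partial>count_space UNIV) = (\<Sum>x\<in>states p. ennreal (?f x))"
    by (rule nn_integral_count_space'[of "states p"]) auto
  also have "\<dots> = ennreal (\<Sum>x\<in>states p. ?f x)"
    by (rule sum_ennreal) (rule nn)
  also have "(\<Sum>x\<in>states p. ?f x) = (\<Sum>x\<in>states p. weight p \<theta> x) / partition_fun p \<theta>"
    by (simp add: sum_divide_distrib)
  also have "\<dots> = 1"
    using partition_fun_pos[of p \<theta>] by (simp add: partition_fun_def)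
  finally have "(\<integral>\<^sup>+x. ennreal (?f x) \<partial>count_space UNIV) = 1" by simp
  with nn show ?thesis
    unfolding network_def by (subst pmf_embed_pmf) auto
qed

lemma grad_eq:
  assumes "e \<in> param_index p"
  shows "grad p X \<theta> e = measure_pmf.expectation (network p \<theta>) (psi e) - data_mean X e"
proof -
  have upd: "(\<Sum>d\<in>param_index p. (\<theta>(e := t)) d * psi d x) =
        t * psi e x + (\<Sum>d\<in>param_index p - {e}. \<theta> d * psi d x)" for t x
    using assms by (subst sum.remove[of _ e]) (auto intro!: sum.cong)
  have w: "((\<lambda>t. weight p (\<theta>(e := t)) x) has_field_derivative weight p \<theta> x * psi e x) (at (\<theta> e))"
    for x
  proof -
    have "((\<lambda>t. weight p (\<theta>(e := t)) x) has_field_derivative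
             weight p (\<theta>(e := \<theta> e)) x * psi e x) (at (\<theta> e))"
      unfolding weight_eq upd by (auto intro!: derivative_eq_intros)
    then show ?thesis by simp
  qed
  have Z: "((\<lambda>t. partition_fun p (\<theta>(e := t))) has_field_derivative
              (\<Sum>x\<in>states p. weight p \<theta> x * psi e x)) (at (\<theta> e))"
    unfolding partition_fun_def by (intro DERIV_sum w)
  have lnZ: "((\<lambda>t. ln (partition_fun p (\<theta>(e := t)))) has_field_derivative
      (\<Sum>x\<in>states p. weight p \<theta> x * psi e x) / partition_fun p \<theta>) (at (\<theta> e))"
    using DERIV_chain2[OF DERIV_ln Z] partition_fun_pos[of p \<theta>]
    by (simp add: divide_simps mult.commute)
  have lin: "((\<lambda>t. \<Sum>x\<leftarrow>X. \<Sum>d\<in>param_index p. (\<theta>(e := t)) d * psi d x) has_field_derivative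
              (\<Sum>x\<leftarrow>X. psi e x)) (at (\<theta> e))"
    unfolding upd by (induction X) (auto intro!: derivative_eq_intros)
  have "((\<lambda>t. objective p X (\<theta>(e := t))) has_field_derivative
      - (\<Sum>x\<leftarrow>X. psi e x) / real (length X)
        + (\<Sum>x\<in>states p. weight p \<theta> x * psi e x) / partition_fun p \<theta>) (at (\<theta> e))"
    unfolding objective_def by (intro DERIV_add DERIV_cdivide DERIV_minus lin lnZ)
  then have "grad p X \<theta> e = (\<Sum>x\<in>states p. weight p \<theta> x * psi e x) / partition_fun p \<theta> - data_mean X e"
    unfolding grad_def data_mean_def by (simp add: DERIV_imp_deriv)
  also have "(\<Sum>x\<in>states p. weight p \<theta> x * psi e x) / partition_fun p \<theta> =
      measure_pmf.expectation (network p \<theta>) (psi e)"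
    by (subst integral_measure_pmf[of "states p"])
       (auto simp: set_pmf_eq pmf_network sum_divide_distrib split: if_splits)
  finally show ?thesis .
qed

end

theory Submission
  imports Defs
begin

text \<open>The error splits into sampling noise and bias.

  Sampling noise: each \<open>\<psi>\<^sub>e\<close> is \<open>0\<close>-\<open>1\<close>-valued, so its variance \<open>\<mu> (1 - \<mu>)\<close> is a Lipschitz function of
  its mean.  Bernstein's inequality therefore already implies an empirical Bernstein bound whose
  linear term is below the factor \<open>14 / 3\<close> present in \<open>\<epsilon>\<close>; no separate concentration
  inequality for the sample variance is needed.

  Bias: instead of coupling two Gibbs chains, a function is averaged backwards along the chain.
  Resampling coordinate \<open>i\<close> sends a function with coordinatewise Lipschitz constants \<open>c\<close> to one
  with constants at most \<open>c\<^sup>T B\<^sub>i\<close>, because \<open>U\<^sub>i\<^sub>j\<close> bounds the change of the conditional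
  probability of coordinate \<open>i\<close> when coordinate \<open>j\<close> is flipped.  After \<open>\<tau>\<close> sweeps the averaged
  \<open>\<psi>\<^sub>e\<close> oscillates by at most the entry sum of \<open>B\<^sup>\<tau>\<close>, and by stationarity its mean under the
  network is the true expectation.\<close>

subsection \<open>Empirical Bernstein inequality for \<open>0\<close>-\<open>1\<close> variables\<close>

text \<open>Second-order Taylor expansion with Lagrange remainder. The factor
  \<open>exp l / 2\<close> is coarser than Bennett's \<open>(exp l - 1 - l) / l\<^sup>2\<close>, but
  combines well with \<open>exp l \<le> 1 / (1 - l)\<close> later on.\<close>

lemma exp_le_quadratic:
  fixes y l :: real
  assumes "\<bar>y\<bar> \<le> l"
  shows "exp y \<le> 1 + y + exp l / 2 * y\<^sup>2"
proof -
  obtain t where t: "\<bar>t\<bar> \<le> \<bar>y\<bar>" "exp y = (\<Sum>m<2. y ^ m / fact m) + exp t / fact 2 * y ^ 2"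
    using Maclaurin_exp_le[of y 2] by blast
  have "exp t \<le> exp l"
    using t(1) assms by simp
  then have "exp t / 2 * y\<^sup>2 \<le> exp l / 2 * y\<^sup>2"
    by (intro mult_right_mono) auto
  with t(2) show ?thesis
    by (simp add: numeral_2_eq_2)
qed

lemma integrable_measure_pmf_bounded:
  fixes f :: "'a \<Rightarrow> real"
  assumes "\<And>x. x \<in> set_pmf M \<Longrightarrow> \<bar>f x\<bar> \<le> c"
  shows "integrable (measure_pmf M) f"
  by (rule measure_pmf.integrable_const_bound[where B = c])
     (use assms in \<open>auto simp: AE_measure_pmf_iff\<close>)

text \<open>Centring removes the linear term; \<open>1 + z \<le> exp z\<close> then gives a bound
  that multiplies over independent trials.\<close>

lemma expectation_exp_centered_le:
  fixes Y :: "'a \<Rightarrow> real"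
  assumes bd: "\<And>x. x \<in> set_pmf M \<Longrightarrow> \<bar>Y x\<bar> \<le> 1"
    and mean: "measure_pmf.expectation M Y = 0"
    and l: "0 \<le> l"
  shows "measure_pmf.expectation M (\<lambda>x. exp (l * Y x))
    \<le> exp (exp l / 2 * l\<^sup>2 * measure_pmf.expectation M (\<lambda>x. (Y x)\<^sup>2))"
proof -
  have le: "\<bar>l * Y x\<bar> \<le> l" if "x \<in> set_pmf M" for x
    using mult_left_mono[OF bd[OF that] l] l by (simp add: abs_mult)
  have iY: "integrable M Y"
    by (rule integrable_measure_pmf_bounded[where c = 1]) (rule bd)
  have iY2: "integrable M (\<lambda>x. (Y x)\<^sup>2)"
    by (rule integrable_measure_pmf_bounded[where c = 1])
       (simp add: abs_square_le_1 bd)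
  have ie: "integrable M (\<lambda>x. exp (l * Y x))"
    by (rule integrable_measure_pmf_bounded[where c = "exp l"]) (use le in force)
  have "measure_pmf.expectation M (\<lambda>x. exp (l * Y x))
      \<le> measure_pmf.expectation M (\<lambda>x. 1 + l * Y x + exp l / 2 * l\<^sup>2 * (Y x)\<^sup>2)"
  proof (intro integral_mono_AE ie Bochner_Integration.integrable_add integrable_mult_right)
    show "AE x in measure_pmf M. exp (l * Y x) \<le> 1 + l * Y x + exp l / 2 * l\<^sup>2 * (Y x)\<^sup>2"
      using exp_le_quadratic[OF le] by (simp add: AE_measure_pmf_iff power_mult_distrib mult.assoc)
  qed (simp_all add: iY iY2)
  also have "\<dots> = 1 + exp l / 2 * l\<^sup>2 * measure_pmf.expectation M (\<lambda>x. (Y x)\<^sup>2)"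
    using iY iY2 by (simp add: mean)
  also have "\<dots> \<le> exp (exp l / 2 * l\<^sup>2 * measure_pmf.expectation M (\<lambda>x. (Y x)\<^sup>2))"
    by (rule exp_ge_add_one_self)
  finally show ?thesis .
qed

text \<open>The chosen \<open>l\<close> minimises the upper bound obtained from \<open>exp l \<le> 1 / (1 - l)\<close>.\<close>

lemma chernoff_exponent:
  fixes a w :: real
  assumes a: "0 < a" and w: "0 \<le> w"
  defines "l \<equiv> a / (w + a)"
  shows "exp l / 2 * l\<^sup>2 * w\<^sup>2 - l * (w * a + a\<^sup>2 / 2) \<le> - (a\<^sup>2 / 2)"
\<comment> \<open>At \<open>w = 0\<close> one has \<open>l = 1\<close>, where
  \<open>1 / (1 - l)\<close> breaks down, but there the variance term vanishes as well.\<close>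
proof (cases "w = 0")
  case True
  then show ?thesis using a by (simp add: l_def)
next
  case False
  with w have w: "0 < w" by simp
  have "1 - l = w / (w + a)"
    using a w by (simp add: l_def field_simps)
  moreover have "1 - l \<le> exp (- l)"
    using exp_ge_add_one_self[of "- l"] by simp
  ultimately have "w / (w + a) \<le> 1 / exp l"
    by (simp add: exp_minus inverse_eq_divide)
  then have "exp l \<le> 1 / (w / (w + a))"
    using a w by (simp add: pos_le_divide_eq mult.commute)
  then have "exp l \<le> (w + a) / w" by simp
  then have "exp l / 2 * l\<^sup>2 * w\<^sup>2 \<le> (w + a) / w / 2 * l\<^sup>2 * w\<^sup>2"
    by (intro mult_right_mono divide_right_mono) auto
  also have "\<dots> = l * (w * a + a\<^sup>2 / 2) - a\<^sup>2 / 2"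
  proof -
    have la: "l * (w + a) = a" using a w by (simp add: l_def)
    have "(w + a) / w / 2 * l\<^sup>2 * w\<^sup>2 = (l * (w + a)) * l * w / 2"
      using w by (simp add: power2_eq_square)
    also have "\<dots> = a * l * w / 2" by (simp add: la)
    also have "\<dots> = l * (w * a + a\<^sup>2 / 2) - a * (l * (w + a)) / 2"
      by (simp add: field_simps power2_eq_square)
    finally show ?thesis by (simp add: la power2_eq_square)
  qed
  finally show ?thesis by simp
qed

text \<open>Chernoff's method: Markov's inequality for the exponential of \<open>l\<close> times the
  sum, whose expectation factors over the independent trials.\<close>

lemma bernstein_Pi_pmf:
  fixes Y :: "'a \<Rightarrow> real"
  assumes bd: "\<And>x. x \<in> set_pmf M \<Longrightarrow> \<bar>Y x\<bar> \<le> 1"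
    and mean: "measure_pmf.expectation M Y = 0"
    and t: "0 < t" and q: "0 < q"
  defines "v \<equiv> measure_pmf.expectation M (\<lambda>x. (Y x)\<^sup>2)"
  shows "measure_pmf.prob (Pi_pmf {..<q} d (\<lambda>_. M))
           {xs. sqrt (2 * v * t) + t \<le> (\<Sum>k<q. Y (xs k)) / real q} \<le> exp (- real q * t)"
proof -
  define P where "P = Pi_pmf {..<q} d (\<lambda>_. M)"
  \<comment> \<open>With these square roots the threshold becomes
    \<open>w * a + a\<^sup>2 / 2\<close>, the shape handled by
    \<open>chernoff_exponent\<close>.\<close>
  define a w where "a = sqrt (2 * t)" and "w = sqrt v"
  define l where "l = a / (w + a)"
  have v: "0 \<le> v" unfolding v_def by simp
  have a: "0 < a" and w: "0 \<le> w" using t v by (auto simp: a_def w_def)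
  have a2: "a\<^sup>2 / 2 = t" and w2: "w\<^sup>2 = v" using t v by (auto simp: a_def w_def)
  have l: "0 < l" using a w by (simp add: l_def)
  have thr: "sqrt (2 * v * t) + t = w * a + a\<^sup>2 / 2"
    unfolding a2 by (simp add: a_def w_def real_sqrt_mult)
  have exp_sum: "exp (l * (\<Sum>k<q. Y (xs k))) = (\<Prod>k<q. exp (l * Y (xs k)))" for xs :: "nat \<Rightarrow> 'a"
    by (simp add: sum_distrib_left exp_sum)
  have ie: "integrable M (\<lambda>x. exp (l * Y x))"
    using bd l by (intro integrable_measure_pmf_bounded[where c = "exp l"]) (force simp: abs_le_iff)
  have iff: "c \<le> S / real q \<longleftrightarrow> exp (l * (real q * c)) \<le> exp (l * S)" for c S
    using l q by (simp add: pos_le_divide_eq mult.commute)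
  have "measure_pmf.prob P {xs. sqrt (2 * v * t) + t \<le> (\<Sum>k<q. Y (xs k)) / real q}
      = measure_pmf.prob P {xs \<in> space (measure_pmf P). exp (l * (real q * (w * a + a\<^sup>2 / 2))) \<le> exp (l * (\<Sum>k<q. Y (xs k)))}"
    unfolding thr iff by simp
  also have "\<dots> \<le> measure_pmf.expectation P (\<lambda>xs. exp (l * (\<Sum>k<q. Y (xs k))))
      / exp (l * (real q * (w * a + a\<^sup>2 / 2)))"
    unfolding exp_sum P_def
    by (intro integral_Markov_inequality_measure[where A = UNIV] integrable_prod_Pi_pmf)
       (auto intro!: ie prod_nonneg)
  also have "measure_pmf.expectation P (\<lambda>xs. exp (l * (\<Sum>k<q. Y (xs k))))
      = measure_pmf.expectation M (\<lambda>x. exp (l * Y x)) ^ q"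
    unfolding exp_sum P_def by (subst expectation_prod_Pi_pmf) (auto intro!: ie)
  also have "\<dots> \<le> exp (exp l / 2 * l\<^sup>2 * w\<^sup>2) ^ q"
    using expectation_exp_centered_le[OF bd mean, of l] l
    by (intro power_mono) (auto simp: w2 v_def)
  also have "exp (exp l / 2 * l\<^sup>2 * w\<^sup>2) ^ q / exp (l * (real q * (w * a + a\<^sup>2 / 2)))
      = exp (real q * (exp l / 2 * l\<^sup>2 * w\<^sup>2 - l * (w * a + a\<^sup>2 / 2)))"
    by (simp add: exp_of_nat_mult[symmetric] exp_diff[symmetric] algebra_simps)
  also have "\<dots> \<le> exp (real q * - t)"
    using chernoff_exponent[OF a w] unfolding l_def[symmetric] a2
    by (subst exp_le_cancel_iff) (intro mult_left_mono, auto)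
  finally show ?thesis
    by (simp add: P_def divide_right_mono)
qed

text \<open>The one-sided bound is applied to \<open>f - \<mu>\<close> and to
  \<open>\<mu> - f\<close>; the union bound costs the factor 2.\<close>

lemma bernstein_01_Pi_pmf:
  fixes f :: "'a \<Rightarrow> real"
  assumes f01: "\<And>x. x \<in> set_pmf M \<Longrightarrow> f x \<in> {0, 1}"
    and t: "0 < t" and q: "0 < q"
  defines "\<mu> \<equiv> measure_pmf.expectation M f"
  shows "measure_pmf.prob (Pi_pmf {..<q} d (\<lambda>_. M))
           {xs. sqrt (2 * (\<mu> * (1 - \<mu>)) * t) + t \<le> \<bar>(\<Sum>k<q. f (xs k)) / real q - \<mu>\<bar>}
         \<le> 2 * exp (- real q * t)"
proof -
  let ?P = "Pi_pmf {..<q} d (\<lambda>_. M)"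
  let ?thr = "sqrt (2 * (\<mu> * (1 - \<mu>)) * t) + t"
  have fb: "0 \<le> f x" "f x \<le> 1" if "x \<in> set_pmf M" for x using f01[OF that] by auto
  have if1: "integrable M f"
    by (rule integrable_measure_pmf_bounded[where c = 1]) (use fb in auto)
  have mu: "0 \<le> \<mu>" "\<mu> \<le> 1"
    using fb unfolding \<mu>_def
    by (auto intro!: integral_nonneg_AE measure_pmf.integral_le_const if1 simp: AE_measure_pmf_iff)
  \<comment> \<open>On the support \<open>f\<close> equals its square, so the variance is a
    polynomial in the mean.\<close>
  have var: "measure_pmf.expectation M (\<lambda>x. (f x - \<mu>)\<^sup>2) = \<mu> * (1 - \<mu>)"
  proof -
    have "measure_pmf.expectation M (\<lambda>x. (f x - \<mu>)\<^sup>2)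
        = measure_pmf.expectation M (\<lambda>x. (1 - 2 * \<mu>) * f x + \<mu>\<^sup>2)"
      by (intro integral_cong_AE) (use f01 in \<open>force simp: AE_measure_pmf_iff power2_eq_square algebra_simps\<close>)+
    also have "\<dots> = (1 - 2 * \<mu>) * \<mu> + \<mu>\<^sup>2"
      using if1 by (simp add: \<mu>_def)
    finally show ?thesis by (simp add: power2_eq_square algebra_simps)
  qed
  have sum_eq: "(\<Sum>k<q. f (xs k) - \<mu>) / real q = (\<Sum>k<q. f (xs k)) / real q - \<mu>" for xs
    using q by (simp add: sum_subtractf diff_divide_distrib)
  have up: "measure_pmf.prob ?P {xs. ?thr \<le> (\<Sum>k<q. f (xs k)) / real q - \<mu>} \<le> exp (- real q * t)"
    using bernstein_Pi_pmf[of M "\<lambda>x. f x - \<mu>" t q d] mu fb if1 t q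
    unfolding sum_eq var by (force simp: \<mu>_def abs_le_iff)
  have "(\<Sum>k<q. \<mu> - f (xs k)) / real q = - ((\<Sum>k<q. f (xs k)) / real q - \<mu>)" for xs
    using q by (simp add: sum_subtractf diff_divide_distrib)
  then have dn: "measure_pmf.prob ?P {xs. ?thr \<le> - ((\<Sum>k<q. f (xs k)) / real q - \<mu>)} \<le> exp (- real q * t)"
    using bernstein_Pi_pmf[of M "\<lambda>x. \<mu> - f x" t q d] mu fb if1 t q var
    by (force simp: \<mu>_def abs_le_iff power2_commute[of _ "f _"])
  have "{xs. ?thr \<le> \<bar>(\<Sum>k<q. f (xs k)) / real q - \<mu>\<bar>}
      = {xs. ?thr \<le> (\<Sum>k<q. f (xs k)) / real q - \<mu>} \<union> {xs. ?thr \<le> - ((\<Sum>k<q. f (xs k)) / real q - \<mu>)}"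
    by auto
  then show ?thesis
    using up dn measure_subadditive[of
        "{xs. ?thr \<le> (\<Sum>k<q. f (xs k)) / real q - \<mu>}" ?P
        "{xs. ?thr \<le> - ((\<Sum>k<q. f (xs k)) / real q - \<mu>)}"]
    by simp
qed

text \<open>Solves for \<open>\<bar>m - \<mu>\<bar>\<close> the quadratic inequality that arises on replacing the variance
  \<open>\<mu> (1 - \<mu>)\<close> by \<open>m (1 - m) + \<bar>m - \<mu>\<bar>\<close>.\<close>

lemma empirical_threshold_le:
  fixes m \<mu> V t :: real
  assumes m: "0 \<le> m" "m \<le> 1" and mu: "0 \<le> \<mu>" "\<mu> \<le> 1" and t: "0 < t"
    and V: "m * (1 - m) \<le> V"
    and dev: "sqrt (2 * V * t) + 14 / 3 * t < \<bar>m - \<mu>\<bar>"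
  shows "sqrt (2 * (\<mu> * (1 - \<mu>)) * t) + t \<le> \<bar>m - \<mu>\<bar>"
proof -
  define D where "D = \<bar>m - \<mu>\<bar>"
  define w where "w = sqrt (2 * V * t)"
  have V0: "0 \<le> V" using V mult_nonneg_nonneg[of m "1 - m"] m by linarith
  have w: "0 \<le> w" "w\<^sup>2 = 2 * V * t" using V0 t by (auto simp: w_def)
  have "\<mu> * (1 - \<mu>) - m * (1 - m) = (m - \<mu>) * (m + \<mu> - 1)"
    by (simp add: algebra_simps)
  also have "\<dots> \<le> \<bar>m - \<mu>\<bar> * \<bar>m + \<mu> - 1\<bar>"
    by (simp flip: abs_mult)
  \<comment> \<open>\<open>u * (1 - u)\<close> has Lipschitz constant 1 on the unit
    interval.\<close>
  also have "\<dots> \<le> D * 1"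
    unfolding D_def using m mu by (intro mult_left_mono) auto
  finally have "\<mu> * (1 - \<mu>) \<le> V + D" using V by simp
  then have "2 * (\<mu> * (1 - \<mu>)) * t \<le> 2 * (V + D) * t"
    using t by simp
  also have "\<dots> = w\<^sup>2 + 2 * D * t" by (simp add: w algebra_simps)
  also have "\<dots> \<le> (D - t)\<^sup>2"
  proof -
    \<comment> \<open>Completing the square turns the goal into
      \<open>w\<^sup>2 + 3 * t\<^sup>2 \<le> (D - 2 * t)\<^sup>2\<close>. Here 8/3 is 14/3 - 2, and
      its square 64/9 exceeds 3.\<close>
    have "w + 8 / 3 * t \<le> D - 2 * t" using dev by (simp add: D_def w_def)
    then have "(w + 8 / 3 * t)\<^sup>2 \<le> (D - 2 * t)\<^sup>2"
      using w t by (intro power_mono) auto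
    moreover have "w\<^sup>2 + 3 * t\<^sup>2 \<le> (w + 8 / 3 * t)\<^sup>2"
    proof -
      have "(w + 8 / 3 * t)\<^sup>2 = w\<^sup>2 + 3 * t\<^sup>2 + 16 / 3 * (w * t) + 37 / 9 * t\<^sup>2"
        by (simp add: power2_eq_square algebra_simps)
      then show ?thesis using mult_nonneg_nonneg[OF w(1), of t] t zero_le_power2[of t] by linarith
    qed
    moreover have "(D - 2 * t)\<^sup>2 - 3 * t\<^sup>2 = (D - t)\<^sup>2 - 2 * D * t"
      by (simp add: power2_eq_square algebra_simps)
    ultimately show ?thesis by linarith
  qed
  finally have "sqrt (2 * (\<mu> * (1 - \<mu>)) * t) \<le> sqrt ((D - t)\<^sup>2)" by (rule real_sqrt_le_mono)
  moreover have "0 \<le> D - t" using dev w(1) t unfolding D_def w_def by linarith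
  ultimately show ?thesis by (simp add: D_def)
qed

subsection \<open>Gibbs updates\<close>

lemma states_upd: "x \<in> states p \<Longrightarrow> i < p \<Longrightarrow> v \<in> {0, 1} \<Longrightarrow> x(i := v) \<in> states p"
  unfolding states_def by (auto simp: PiE_iff extensional_def)

lemma states_val: "x \<in> states p \<Longrightarrow> i < p \<Longrightarrow> x i \<in> {0, 1}"
  unfolding states_def by (auto simp: PiE_iff)

lemma set_network: "set_pmf (network p \<theta>) = states p"
  using weight_pos[of p \<theta>, THEN less_imp_neq, THEN not_sym]
    partition_fun_pos[of p \<theta>, THEN less_imp_neq, THEN not_sym]
  by (auto simp: set_pmf_eq pmf_network)

lemma states_agree:
  assumes "x \<in> states p" "i < p"
  shows "states p \<inter> {y. \<forall>k. k \<noteq> i \<longrightarrow> y k = x k} = {x(i := 0), x(i := 1)}"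
proof (rule equalityI; rule subsetI)
  fix y assume y: "y \<in> states p \<inter> {y. \<forall>k. k \<noteq> i \<longrightarrow> y k = x k}"
  then have "y = x(i := y i)" by auto
  moreover have "y i = 0 \<or> y i = 1" using states_val[of y p i] y assms(2) by simp
  ultimately show "y \<in> {x(i := 0), x(i := 1)}" by (metis insertCI)
next
  fix y assume "y \<in> {x(i := 0), x(i := 1)}"
  then show "y \<in> states p \<inter> {y. \<forall>k. k \<noteq> i \<longrightarrow> y k = x k}"
    using states_upd[OF assms, of 0] states_upd[OF assms, of 1] by auto
qed

text \<open>Under the conditioning \<open>y\<close> agrees with \<open>x\<close> off
  \<open>i\<close>, so inserting \<open>y i\<close> into \<open>x\<close> rebuilds \<open>y\<close>.
  In this form stationarity is a general fact about conditioning.\<close>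

lemma gibbs_update_eq_cond_pmf:
  assumes "x \<in> states p" "i < p"
  shows "gibbs_update p \<theta> i x = cond_pmf (network p \<theta>) {y. \<forall>k. k \<noteq> i \<longrightarrow> y k = x k}"
proof -
  have *: "set_pmf (network p \<theta>) \<inter> {y. \<forall>k. k \<noteq> i \<longrightarrow> y k = x k} \<noteq> {}"
    using states_agree[OF assms] by (simp add: set_network)
  show ?thesis
    unfolding gibbs_update_def conditional_def map_pmf_comp
    by (rule map_pmf_idI) (auto simp: set_cond_pmf[OF *])
qed

lemma set_gibbs_update:
  assumes "x \<in> states p" "i < p"
  shows "set_pmf (gibbs_update p \<theta> i x) = {x(i := 0), x(i := 1)}"
  using states_agree[OF assms]
  by (simp add: gibbs_update_eq_cond_pmf[OF assms] set_cond_pmf set_network)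

text \<open>Agreement off \<open>i\<close> is an equivalence relation; drawing a class from the law
  and then redrawing within the class reproduces the law.\<close>

lemma network_bind_gibbs_update:
  assumes "i < p"
  shows "bind_pmf (network p \<theta>) (gibbs_update p \<theta> i) = network p \<theta>"
proof -
  have "bind_pmf (network p \<theta>) (gibbs_update p \<theta> i)
      = bind_pmf (network p \<theta>) (\<lambda>x. cond_pmf (network p \<theta>) {y. \<forall>k. k \<noteq> i \<longrightarrow> y k = x k})"
    using assms by (intro bind_pmf_cong) (auto simp: set_network gibbs_update_eq_cond_pmf)
  also have "\<dots> = network p \<theta>"
    by (rule bind_cond_pmf_cancel) (auto intro!: arg_cong[where f = "measure _"])
  finally show ?thesis .
qed

subsection \<open>The conditional odds\<close>

text \<open>The odds of \<open>x\<^sub>i = 0\<close> against \<open>x\<^sub>i = 1\<close> given the other coordinates.\<close>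

definition odds :: "nat \<Rightarrow> params \<Rightarrow> nat \<Rightarrow> state \<Rightarrow> real" where
  "odds p \<theta> i x = exp (- xi \<theta> i i - (\<Sum>k\<in>{..<p} - {i}. xi \<theta> i k * x k))"

lemma weight_upd_0:
  assumes i: "i < p"
  shows "weight p \<theta> (x(i := 0)) = weight p \<theta> (x(i := 1)) * odds p \<theta> i x"
proof -
  let ?y = "x(i := 1)"
  \<comment> \<open>\<open>h\<close> enumerates the index pairs containing \<open>i\<close>; the
    statistics of all other pairs do not see coordinate \<open>i\<close>.\<close>
  define h where "h k = (min i k, max i k)" for k
  have inj: "inj_on h {..<p}"
    by (auto simp: inj_on_def h_def min_def max_def split: if_splits)
  have sub: "h ` {..<p} \<subseteq> param_index p"
    using i by (auto simp: h_def param_index_def min_def max_def)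
  have "(\<Sum>e\<in>param_index p. \<theta> e * psi e ?y) - (\<Sum>e\<in>param_index p. \<theta> e * psi e (x(i := 0)))
      = (\<Sum>e\<in>param_index p. \<theta> e * (psi e ?y - psi e (x(i := 0))))"
    by (simp add: sum_subtractf right_diff_distrib)
  also have "\<dots> = (\<Sum>e\<in>h ` {..<p}. \<theta> e * (psi e ?y - psi e (x(i := 0))))"
  proof (rule sum.mono_neutral_right[OF finite_param_index sub], rule ballI)
    fix e assume e: "e \<in> param_index p - h ` {..<p}"
    obtain a c where ac: "e = (a, c)" by fastforce
    have "a \<noteq> i \<and> c \<noteq> i"
    proof (rule ccontr)
      assume "\<not> (a \<noteq> i \<and> c \<noteq> i)"
      then have "e = h c \<or> e = h a" "a < p" "c < p"
        using e by (auto simp: ac h_def param_index_def min_def max_def)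
      with e show False by auto
    qed
    then show "\<theta> e * (psi e ?y - psi e (x(i := 0))) = 0"
      by (simp add: ac psi_def)
  qed
  also have "\<dots> = (\<Sum>k<p. \<theta> (h k) * (psi (h k) ?y - psi (h k) (x(i := 0))))"
    by (simp add: sum.reindex[OF inj])
  also have "\<dots> = (\<Sum>k<p. xi \<theta> i k * ?y k)"
    by (intro sum.cong) (auto simp: h_def psi_def xi_def min_def max_def)
  also have "\<dots> = xi \<theta> i i + (\<Sum>k\<in>{..<p} - {i}. xi \<theta> i k * x k)"
    using i by (simp add: sum.remove[of _ i])
  finally show ?thesis
    by (simp add: weight_eq odds_def exp_add[symmetric])
qed

lemma odds_pos: "0 < odds p \<theta> i x"
  by (simp add: odds_def)

text \<open>The value 1 is drawn with probability \<open>1 / (1 + odds p \<theta> i x)\<close>. In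
  this affine form the odds are the only trace of the conditional law, so perturbing another
  coordinate can be tracked through them.\<close>

lemma expectation_gibbs_update:
  assumes x: "x \<in> states p" and i: "i < p"
  shows "measure_pmf.expectation (gibbs_update p \<theta> i x) f
    = f (x(i := 0)) + (f (x(i := 1)) - f (x(i := 0))) * (1 / (1 + odds p \<theta> i x))"
proof -
  let ?N = "network p \<theta>" and ?S = "{y. \<forall>k. k \<noteq> i \<longrightarrow> y k = x k}"
  let ?W = "weight p \<theta> (x(i := 1))" and ?o = "odds p \<theta> i x" and ?Z = "partition_fun p \<theta>"
  have ne: "x(i := 0) \<noteq> x(i := 1)"
    by (metis fun_upd_same zero_neq_one)
  have st: "x(i := 0) \<in> states p" "x(i := 1) \<in> states p"
    using states_upd[OF x i] by auto
  have S: "set_pmf ?N \<inter> ?S = {x(i := 0), x(i := 1)}"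
    using states_agree[OF x i] by (simp add: set_network)
  have "measure ?N ?S = measure ?N {x(i := 0), x(i := 1)}"
    using measure_Int_set_pmf[of ?N ?S] unfolding Int_commute[of ?S] S by simp
  also have "\<dots> = ?W * (1 + ?o) / ?Z"
    using ne st by (simp add: measure_measure_pmf_finite pmf_network weight_upd_0[OF i] distrib_left add_divide_distrib)
  finally have mS: "measure ?N ?S = ?W * (1 + ?o) / ?Z" .
  have pos: "0 < ?W" "0 < ?o" "0 < ?Z"
    by (simp_all add: weight_pos odds_pos partition_fun_pos)
  have nz: "set_pmf ?N \<inter> ?S \<noteq> {}" using S by simp
  have "pmf (cond_pmf ?N ?S) (x(i := 0)) = ?o / (1 + ?o)"
       "pmf (cond_pmf ?N ?S) (x(i := 1)) = 1 / (1 + ?o)"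
    unfolding pmf_cond[OF nz] mS using pos st
    by (simp_all add: pmf_network weight_upd_0[OF i])
  then have "measure_pmf.expectation (gibbs_update p \<theta> i x) f
      = f (x(i := 0)) * (?o / (1 + ?o)) + f (x(i := 1)) * (1 / (1 + ?o))"
    unfolding gibbs_update_eq_cond_pmf[OF x i]
    using ne by (subst integral_measure_pmf_real[where A = "{x(i := 0), x(i := 1)}"])
      (auto simp: set_cond_pmf[OF nz] S)
  also have "?o / (1 + ?o) = 1 - 1 / (1 + ?o)"
    using pos by (simp add: field_simps)
  finally have E: "measure_pmf.expectation (gibbs_update p \<theta> i x) f
      = f (x(i := 0)) * (1 - 1 / (1 + ?o)) + f (x(i := 1)) * (1 / (1 + ?o))" .
  show ?thesis
    unfolding E by (simp only: left_diff_distrib right_diff_distrib mult_1_right)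
qed

subsection \<open>Influence of one coordinate on another\<close>

lemma odds_upd_1:
  assumes "i \<noteq> j" "j < p"
  shows "odds p \<theta> i (x(j := 1)) = odds p \<theta> i (x(j := 0)) * exp (- xi \<theta> i j)"
proof -
  have j: "j \<in> {..<p} - {i}" using assms by auto
  show ?thesis
    unfolding odds_def sum.remove[OF finite_Diff[OF finite_lessThan] j]
    by (simp add: exp_add[symmetric])
qed

text \<open>Each term \<open>xi \<theta> i k * x k\<close> lies between the negative and the
  positive part of \<open>xi \<theta> i k\<close>, which is what the \<open>sgn\<close> expressions
  in the two bounds compute.\<close>

lemma odds_upd_0_bounds:
  assumes x: "x \<in> states p" and ij: "i \<noteq> j" "j < p"
  shows "r_bound p \<theta> i j \<le> odds p \<theta> i (x(j := 0))"
    and "odds p \<theta> i (x(j := 0)) \<le> s_bound p \<theta> i j"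
proof -
  have j: "j \<in> {..<p} - {i}" using ij by auto
  have diff: "{..<p} - {i} - {j} = {..<p} - {i, j}" by auto
  have eq: "odds p \<theta> i (x(j := 0)) = exp (- xi \<theta> i i - (\<Sum>k\<in>{..<p} - {i, j}. xi \<theta> i k * x k))"
    unfolding odds_def sum.remove[OF finite_Diff[OF finite_lessThan] j] by (simp add: diff)
  have "xi \<theta> i k * max (- sgn (xi \<theta> i k)) 0 \<le> xi \<theta> i k * x k \<and>
        xi \<theta> i k * x k \<le> xi \<theta> i k * max (sgn (xi \<theta> i k)) 0" if "k \<in> {..<p} - {i, j}" for k
    using states_val[OF x, of k] that by (auto simp: sgn_if)
  then show "r_bound p \<theta> i j \<le> odds p \<theta> i (x(j := 0))"
    and "odds p \<theta> i (x(j := 0)) \<le> s_bound p \<theta> i j"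
    unfolding eq r_bound_def s_bound_def by (auto intro!: sum_mono)
qed

lemma b_star_pos: "0 < b_star p \<theta> i j"
  by (simp add: b_star_def r_bound_def less_max_iff_disj)

text \<open>\<open>b / ((1 + b c) (1 + b))\<close> is the reciprocal of \<open>1 / b + c b + 1 + c\<close>, which is minimal at
  \<open>1 / sqrt c\<close>; hence the clamped point maximises it over an interval.\<close>

lemma clamp_maximises:
  fixes b c e r s :: real
  assumes c: "0 < c" and e: "0 < e" "c * e\<^sup>2 = 1" and r: "0 < r" and b: "r \<le> b" "b \<le> s"
  defines "b' \<equiv> max r (min s e)"
  shows "b / ((1 + b * c) * (1 + b)) \<le> b' / ((1 + b' * c) * (1 + b'))"
proof -
  have pos: "0 < b" "0 < b'" using r b by (auto simp: b'_def)
  \<comment> \<open>After clearing denominators the two sides differ by this product. Its factors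
    agree in sign because \<open>c * b * b'\<close> is compared with 1 according to the side of
    \<open>e\<close> on which \<open>b\<close> and \<open>b'\<close> lie.\<close>
  have key: "0 \<le> (b - b') * (c * b * b' - 1)"
  proof -
    have sq: "c * u * v \<ge> 1" if "e \<le> u" "e \<le> v" for u v
    proof -
      have "e * e \<le> u * v" using that e by (intro mult_mono) auto
      then have "c * (e * e) \<le> c * (u * v)" using c by simp
      then show ?thesis using e by (simp add: power2_eq_square algebra_simps)
    qed
    have sq': "c * u * v \<le> 1" if "u \<le> e" "v \<le> e" "0 < u" "0 < v" for u v
    proof -
      have "u * v \<le> e * e" using that e by (intro mult_mono) auto
      then have "c * (u * v) \<le> c * (e * e)" using c by simp
      then show ?thesis using e by (simp add: power2_eq_square algebra_simps)
    qed
    consider "e < r" "b' = r" | "s < e" "b' = s" | "b' = e" using b by (force simp: b'_def)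
    then show ?thesis
    proof cases
      case 1
      then show ?thesis using sq[of b b'] b by (intro mult_nonneg_nonneg) auto
    next
      case 2
      then show ?thesis using sq'[of b b'] b pos by (intro mult_nonpos_nonpos) auto
    next
      case 3
      then show ?thesis using sq[of b b'] sq'[of b b'] pos
        by (cases "b \<le> e") (auto intro: mult_nonpos_nonpos)
    qed
  qed
  have "b * ((1 + b' * c) * (1 + b')) \<le> b' * ((1 + b * c) * (1 + b))"
  proof -
    have "b' * ((1 + b * c) * (1 + b)) - b * ((1 + b' * c) * (1 + b')) = (b - b') * (c * b * b' - 1)"
      by (simp add: algebra_simps)
    with key show ?thesis by linarith
  qed
  then show ?thesis using pos c by (simp add: divide_le_eq le_divide_eq field_simps add_pos_pos)
qed

lemma U_mat_index:
  "i < p \<Longrightarrow> j < p \<Longrightarrow> U_mat p \<theta> $$ (i, j) = \<bar>exp (- xi \<theta> i j) - 1\<bar> *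
     (b_star p \<theta> i j / ((1 + b_star p \<theta> i j * exp (- xi \<theta> i j)) * (1 + b_star p \<theta> i j)))"
  by (simp add: U_mat_def)

lemma U_mat_nonneg: "i < p \<Longrightarrow> j < p \<Longrightarrow> 0 \<le> U_mat p \<theta> $$ (i, j)"
  using b_star_pos[of p \<theta> i j] by (simp add: U_mat_index)

text \<open>Setting \<open>x j\<close> from 0 to 1 multiplies the odds by
  \<open>exp (- xi \<theta> i j)\<close>. The resulting change of probability is an explicit
  function of the odds at \<open>x j = 0\<close>, which \<open>clamp_maximises\<close> bounds over
  the range from \<open>r_bound\<close> to \<open>s_bound\<close>, with peak at
  \<open>exp (xi \<theta> i j / 2)\<close>.\<close>

lemma influence_le_U_mat:
  assumes x: "x \<in> states p" and i: "i < p" and j: "j < p" "i \<noteq> j" and v: "v \<in> {0, 1}"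
  shows "\<bar>1 / (1 + odds p \<theta> i (x(j := v))) - 1 / (1 + odds p \<theta> i x)\<bar> \<le> U_mat p \<theta> $$ (i, j)"
proof -
  let ?b = "odds p \<theta> i (x(j := 0))" and ?c = "exp (- xi \<theta> i j)"
  have b: "0 < ?b" by (rule odds_pos)
  have "1 / (1 + ?b * ?c) - 1 / (1 + ?b) = (1 - ?c) * (?b / ((1 + ?b * ?c) * (1 + ?b)))"
  proof -
    have "0 < 1 + ?b * ?c" "0 < 1 + ?b" using b by (auto intro!: add_pos_pos)
    then have "1 + ?b * ?c \<noteq> 0" "1 + ?b \<noteq> 0" by linarith+
    then show ?thesis by (simp add: diff_frac_eq) (simp add: algebra_simps)
  qed
  then have "\<bar>1 / (1 + ?b * ?c) - 1 / (1 + ?b)\<bar> = \<bar>?c - 1\<bar> * (?b / ((1 + ?b * ?c) * (1 + ?b)))"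
    using b by (simp add: abs_mult abs_minus_commute)
  also have "\<dots> \<le> U_mat p \<theta> $$ (i, j)"
    unfolding U_mat_index[OF i j(1)] b_star_def
    using odds_upd_0_bounds[OF x j(2,1)]
    by (intro mult_left_mono clamp_maximises)
       (auto simp: power2_eq_square r_bound_def simp flip: exp_add)
  finally have main: "\<bar>1 / (1 + odds p \<theta> i (x(j := 1))) - 1 / (1 + ?b)\<bar> \<le> U_mat p \<theta> $$ (i, j)"
    by (simp add: odds_upd_1[OF j(2,1)])
  have "x j \<in> {0, 1}" using states_val[OF x j(1)] .
  \<comment> \<open>Either nothing changes, or the two states are \<open>x(j := 0)\<close> and
    \<open>x(j := 1)\<close> in some order.\<close>
  then consider "x(j := v) = x" | "v = 1" "x = x(j := 0)" | "v = 0" "x = x(j := 1)"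
    using v by (metis empty_iff fun_upd_triv insert_iff)
  then show ?thesis
  proof cases
    case 1
    then show ?thesis using U_mat_nonneg[OF i j(1)] by simp
  next
    case 2
    then show ?thesis using main by metis
  next
    case 3
    then show ?thesis using main by (metis abs_minus_commute)
  qed
qed

subsection \<open>Propagation of Lipschitz constants\<close>

definition coord_lipschitz :: "nat \<Rightarrow> (nat \<Rightarrow> real) \<Rightarrow> (state \<Rightarrow> real) \<Rightarrow> bool" where
  "coord_lipschitz p c f \<longleftrightarrow> (\<forall>x\<in>states p. \<forall>j<p. \<forall>v\<in>{0, 1}. \<bar>f (x(j := v)) - f x\<bar> \<le> c j)"

text \<open>The kernel acts backwards on functions, and the row vector of constants is multiplied by
  \<open>M\<close> from the right. Nonnegativity and invariance of \<open>states p\<close> are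
  carried along so that the predicate is closed under composition.\<close>

definition dominated :: "nat \<Rightarrow> (state \<Rightarrow> state pmf) \<Rightarrow> real mat \<Rightarrow> bool" where
  "dominated p K M \<longleftrightarrow> M \<in> carrier_mat p p \<and> (\<forall>k<p. \<forall>j<p. 0 \<le> M $$ (k, j)) \<and>
     (\<forall>x\<in>states p. set_pmf (K x) \<subseteq> states p) \<and>
     (\<forall>c f. (\<forall>j<p. 0 \<le> c j) \<longrightarrow> coord_lipschitz p c f \<longrightarrow>
        coord_lipschitz p (\<lambda>j. \<Sum>k<p. c k * M $$ (k, j)) (\<lambda>x. measure_pmf.expectation (K x) f))"

lemma coord_lipschitzD:
  "coord_lipschitz p c f \<Longrightarrow> x \<in> states p \<Longrightarrow> j < p \<Longrightarrow> v \<in> {0, 1} \<Longrightarrow>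
    \<bar>f (x(j := v)) - f x\<bar> \<le> c j"
  unfolding coord_lipschitz_def by blast

lemma dominatedI:
  assumes "M \<in> carrier_mat p p" "\<And>k j. k < p \<Longrightarrow> j < p \<Longrightarrow> 0 \<le> M $$ (k, j)"
    and "\<And>x. x \<in> states p \<Longrightarrow> set_pmf (K x) \<subseteq> states p"
    and "\<And>c f. \<forall>j<p. 0 \<le> c j \<Longrightarrow> coord_lipschitz p c f \<Longrightarrow>
      coord_lipschitz p (\<lambda>j. \<Sum>k<p. c k * M $$ (k, j)) (\<lambda>x. measure_pmf.expectation (K x) f)"
  shows "dominated p K M"
  using assms by (simp add: dominated_def)

lemma dominatedD:
  assumes "dominated p K M"
  shows "M \<in> carrier_mat p p"
    and "\<And>k j. k < p \<Longrightarrow> j < p \<Longrightarrow> 0 \<le> M $$ (k, j)"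
    and "\<And>x. x \<in> states p \<Longrightarrow> set_pmf (K x) \<subseteq> states p"
    and "\<And>c f. \<forall>j<p. 0 \<le> c j \<Longrightarrow> coord_lipschitz p c f \<Longrightarrow>
      coord_lipschitz p (\<lambda>j. \<Sum>k<p. c k * M $$ (k, j)) (\<lambda>x. measure_pmf.expectation (K x) f)"
  using assms by (simp_all add: dominated_def)

lemma coord_lipschitz_cong:
  assumes "\<And>x. x \<in> states p \<Longrightarrow> f x = g x" "\<And>j. j < p \<Longrightarrow> c j = d j"
  shows "coord_lipschitz p c f \<longleftrightarrow> coord_lipschitz p d g"
  unfolding coord_lipschitz_def using assms states_upd by (intro ball_cong all_cong refl) auto

lemma expectation_bind_states:
  fixes f :: "state \<Rightarrow> real"
  assumes "set_pmf M \<subseteq> states p" "\<And>x. x \<in> states p \<Longrightarrow> set_pmf (K x) \<subseteq> states p"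
  shows "measure_pmf.expectation (bind_pmf M K) f =
    measure_pmf.expectation M (\<lambda>x. measure_pmf.expectation (K x) f)"
proof -
  have "measure_pmf.expectation (bind_pmf M K) f =
      (\<Sum>x\<in>states p. pmf M x *\<^sub>R measure_pmf.expectation (K x) f)"
    using assms finite_subset[OF assms(2) finite_states] by (intro pmf_expectation_bind) auto
  also have "\<dots> = measure_pmf.expectation M (\<lambda>x. measure_pmf.expectation (K x) f)"
    using assms(1) by (intro integral_measure_pmf[symmetric]) auto
  finally show ?thesis .
qed

lemma dominated_return: "dominated p return_pmf (1\<^sub>m p)"
proof -
  have "(\<Sum>k<p. c k * 1\<^sub>m p $$ (k, j)) = c j" if "j < p" for c :: "nat \<Rightarrow> real" and j
  proof -
    have "(\<Sum>k<p. c k * 1\<^sub>m p $$ (k, j)) = (\<Sum>k<p. if k = j then c k else 0)"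
      using that by (intro sum.cong) auto
    then show ?thesis using that by simp
  qed
  then show ?thesis
    by (intro dominatedI) (auto cong: coord_lipschitz_cong)
qed

text \<open>Averaging is backwards: \<open>L\<close>, the later kernel, acts on the function first.
  Hence \<open>N\<close> meets the row vector before \<open>M\<close>, matching the left
  multiplication in \<open>B_mat\<close>.\<close>

lemma dominated_bind:
  assumes K: "dominated p K M" and L: "dominated p L N"
  shows "dominated p (\<lambda>x. bind_pmf (K x) L) (N * M)"
proof -
  note M = dominatedD(1,2)[OF K] and N = dominatedD(1,2)[OF L]
    and sK = dominatedD(3)[OF K] and sL = dominatedD(3)[OF L]
  have NM: "(N * M) $$ (l, j) = (\<Sum>k<p. N $$ (l, k) * M $$ (k, j))" if "l < p" "j < p" for l j
    using M(1) N(1) that by (simp add: scalar_prod_def lessThan_atLeast0)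
  have "coord_lipschitz p (\<lambda>j. \<Sum>l<p. c l * (N * M) $$ (l, j))
          (\<lambda>x. measure_pmf.expectation (bind_pmf (K x) L) f)"
    if c: "\<forall>j<p. 0 \<le> c j" and f: "coord_lipschitz p c f" for c f
  proof -
    let ?d = "\<lambda>k. \<Sum>l<p. c l * N $$ (l, k)"
    have "coord_lipschitz p ?d (\<lambda>x. measure_pmf.expectation (L x) f)"
      using dominatedD(4)[OF L c f] .
    moreover have "\<forall>k<p. 0 \<le> ?d k"
      using c N(2) by (auto intro!: sum_nonneg)
    ultimately have "coord_lipschitz p (\<lambda>j. \<Sum>k<p. ?d k * M $$ (k, j))
        (\<lambda>x. measure_pmf.expectation (K x) (\<lambda>y. measure_pmf.expectation (L y) f))"
      by (intro dominatedD(4)[OF K])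
    moreover have "(\<Sum>k<p. ?d k * M $$ (k, j)) = (\<Sum>l<p. c l * (N * M) $$ (l, j))" if "j < p" for j
    proof -
      have "(\<Sum>k<p. ?d k * M $$ (k, j)) = (\<Sum>k<p. \<Sum>l<p. c l * (N $$ (l, k) * M $$ (k, j)))"
        by (simp add: sum_distrib_right mult.assoc)
      also have "\<dots> = (\<Sum>l<p. \<Sum>k<p. c l * (N $$ (l, k) * M $$ (k, j)))"
        by (rule sum.swap)
      finally show ?thesis using that by (simp add: NM sum_distrib_left)
    qed
    ultimately show ?thesis
      by (subst coord_lipschitz_cong) (auto intro: expectation_bind_states[OF sK sL])
  qed
  moreover have "0 \<le> (N * M) $$ (l, j)" if "l < p" "j < p" for l j
    using that M(2) N(2) by (auto simp: NM intro!: sum_nonneg)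
  moreover have "set_pmf (bind_pmf (K x) L) \<subseteq> states p" if "x \<in> states p" for x
    using sK[OF that] sL by auto
  moreover have "N * M \<in> carrier_mat p p" using M(1) N(1) by simp
  ultimately show ?thesis by (intro dominatedI) auto
qed

lemma dominated_gibbs_update:
  assumes i: "i < p"
  shows "dominated p (gibbs_update p \<theta> i) (B_row p \<theta> i)"
proof -
  have B: "B_row p \<theta> i $$ (k, l) = (if k = i then U_mat p \<theta> $$ (i, l) else if k = l then 1 else 0)"
    if "k < p" "l < p" for k l
    using that by (simp add: B_row_def)
  \<comment> \<open>Column \<open>j\<close> collects the influence through coordinate
    \<open>i\<close> and the old constant, which disappears for \<open>j = i\<close> because that
    coordinate is overwritten.\<close>
  have row: "(\<Sum>k<p. c k * B_row p \<theta> i $$ (k, j))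
      = c i * U_mat p \<theta> $$ (i, j) + (if j = i then 0 else c j)" if "j < p" for c j
  proof -
    have "(\<Sum>k<p. c k * B_row p \<theta> i $$ (k, j))
        = c i * U_mat p \<theta> $$ (i, j) + (\<Sum>k\<in>{..<p} - {i}. c k * B_row p \<theta> i $$ (k, j))"
      using i that by (simp add: sum.remove[of _ i] B)
    also have "(\<Sum>k\<in>{..<p} - {i}. c k * B_row p \<theta> i $$ (k, j))
        = (\<Sum>k\<in>{..<p} - {i}. if k = j then c k else 0)"
      using that by (intro sum.cong) (auto simp: B)
    also have "\<dots> = (if j = i then 0 else c j)" using that by simp
    finally show ?thesis .
  qed
  have "coord_lipschitz p (\<lambda>j. \<Sum>k<p. c k * B_row p \<theta> i $$ (k, j))
          (\<lambda>x. measure_pmf.expectation (gibbs_update p \<theta> i x) f)"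
    if c: "\<forall>j<p. 0 \<le> c j" and f: "coord_lipschitz p c f" for c f
    unfolding coord_lipschitz_def
  proof (intro ballI allI impI)
    fix x j and v :: real
    assume x: "x \<in> states p" and j: "j < p" and v: "v \<in> {0, 1}"
    define x' where "x' = x(j := v)"
    have x': "x' \<in> states p" using states_upd[OF x j v] by (simp add: x'_def)
    note E = expectation_gibbs_update[OF x i, of \<theta> f] expectation_gibbs_update[OF x' i, of \<theta> f]
    show "\<bar>measure_pmf.expectation (gibbs_update p \<theta> i (x(j := v))) f
        - measure_pmf.expectation (gibbs_update p \<theta> i x) f\<bar> \<le> (\<Sum>k<p. c k * B_row p \<theta> i $$ (k, j))"
    proof (cases "j = i")
      \<comment> \<open>The update forgets the old value of coordinate \<open>i\<close>, so both
        expectations coincide and the bound only has to be nonnegative.\<close>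
      case True
      have "odds p \<theta> i x' = odds p \<theta> i x"
        by (simp add: odds_def x'_def True)
      moreover have "x'(i := w) = x(i := w)" for w
        by (simp add: x'_def True)
      ultimately have "measure_pmf.expectation (gibbs_update p \<theta> i x') f
          = measure_pmf.expectation (gibbs_update p \<theta> i x) f"
        unfolding E by simp
      moreover have "0 \<le> c i * U_mat p \<theta> $$ (i, j)"
        using c i U_mat_nonneg[OF i j] by simp
      ultimately show ?thesis unfolding row[OF j] by (simp add: True x'_def)
    next
      case False
      define s s' where "s = 1 / (1 + odds p \<theta> i x)" and "s' = 1 / (1 + odds p \<theta> i x')"
      define d0 d1 where "d0 = f (x'(i := 0)) - f (x(i := 0))" and "d1 = f (x'(i := 1)) - f (x(i := 1))"
      define g where "g = f (x(i := 1)) - f (x(i := 0))"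
      have tw: "x'(i := w) = (x(i := w))(j := v)" for w
        using False by (simp add: x'_def fun_upd_twist)
      have d: "\<bar>d0\<bar> \<le> c j" "\<bar>d1\<bar> \<le> c j"
        unfolding d0_def d1_def tw
        by (auto intro!: coord_lipschitzD[OF f _ j v] states_upd[OF x i])
      have g: "\<bar>g\<bar> \<le> c i"
        using coord_lipschitzD[OF f states_upd[OF x i, of 0] i, of 1] by (simp add: g_def)
      have s: "\<bar>s' - s\<bar> \<le> U_mat p \<theta> $$ (i, j)"
        using influence_le_U_mat[OF x i j _ v, of \<theta>] False by (auto simp: s_def s'_def x'_def)
      have s01: "0 \<le> s'" "s' \<le> 1"
        using odds_pos[of p \<theta> i x'] by (auto simp: s'_def)
      \<comment> \<open>The first part is a convex combination of changes in coordinate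
        \<open>j\<close> at a common new value of \<open>i\<close>; the second is the shift in
        probability times the jump of \<open>f\<close> in coordinate \<open>i\<close>.\<close>
      have "measure_pmf.expectation (gibbs_update p \<theta> i x') f
          - measure_pmf.expectation (gibbs_update p \<theta> i x) f
          = (s' * d1 + (1 - s') * d0) + (s' - s) * g"
        unfolding E s_def[symmetric] s'_def[symmetric] by (simp add: d0_def d1_def g_def algebra_simps)
      also have "\<bar>\<dots>\<bar> \<le> \<bar>s' * d1\<bar> + \<bar>(1 - s') * d0\<bar> + \<bar>(s' - s) * g\<bar>"
        by linarith
      also have "\<dots> \<le> s' * c j + (1 - s') * c j + U_mat p \<theta> $$ (i, j) * c i"
        unfolding abs_mult using s01 d s g U_mat_nonneg[OF i j]
        by (intro add_mono mult_mono) auto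
      also have "\<dots> = (\<Sum>k<p. c k * B_row p \<theta> i $$ (k, j))"
        using False by (simp add: row[OF j] algebra_simps)
      finally show ?thesis by (simp add: x'_def)
    qed
  qed
  moreover have "set_pmf (gibbs_update p \<theta> i x) \<subseteq> states p" if "x \<in> states p" for x
    using states_upd[OF that i] by (simp add: set_gibbs_update[OF that i])
  moreover have "0 \<le> B_row p \<theta> i $$ (k, l)" if "k < p" "l < p" for k l
    using U_mat_nonneg[OF i that(2)] by (simp add: B[OF that])
  moreover have "B_row p \<theta> i \<in> carrier_mat p p" by (simp add: B_row_def)
  ultimately show ?thesis by (intro dominatedI) auto
qed

lemma dominated_gibbs1: "dominated p (gibbs1 p \<theta>) (B_mat p \<theta>)"
proof -
  have "dominated p (\<lambda>x. foldl (\<lambda>M i. bind_pmf M (gibbs_update p \<theta> i)) (return_pmf x) [0..<n])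
          (foldl (\<lambda>M i. B_row p \<theta> i * M) (1\<^sub>m p) [0..<n])" if "n \<le> p" for n
    using that
  proof (induction n)
    case 0
    show ?case using dominated_return by simp
  next
    case (Suc n)
    then show ?case
      using dominated_bind[OF Suc.IH dominated_gibbs_update[of n p \<theta>]] by simp
  qed
  then show ?thesis
    by (simp add: gibbs1_def[abs_def] B_mat_def)
qed

text \<open>Matrix powers unfold on the right, whereas \<open>dominated_bind\<close> puts the newest
  factor on the left.\<close>

lemma pow_mat_Suc_left: "A \<in> carrier_mat n n \<Longrightarrow> A ^\<^sub>m Suc k = A * A ^\<^sub>m k"
  for A :: "'a :: semiring_1 mat"
proof (induction k)
  case (Suc k)
  have "A ^\<^sub>m Suc (Suc k) = A * A ^\<^sub>m k * A" using Suc by simp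
  also have "\<dots> = A * (A ^\<^sub>m k * A)" using Suc.prems by (intro assoc_mult_mat) auto
  finally show ?case by simp
qed simp

lemma dominated_gibbs: "dominated p (gibbs p \<theta> \<tau>) (B_mat p \<theta> ^\<^sub>m \<tau>)"
proof (induction \<tau>)
  case 0
  have "B_mat p \<theta> \<in> carrier_mat p p" by (rule dominatedD(1)[OF dominated_gibbs1])
  then show ?case using dominated_return by (simp add: gibbs_def[abs_def])
next
  case (Suc \<tau>)
  have "B_mat p \<theta> \<in> carrier_mat p p" by (rule dominatedD(1)[OF dominated_gibbs1])
  then show ?case
    using dominated_bind[OF Suc dominated_gibbs1, of \<theta>]
    by (simp only: pow_mat_Suc_left) (simp add: gibbs_def[abs_def])
qed

section \<open>Stationarity of the network and bias of the chain\<close>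

lemma network_bind_gibbs1: "bind_pmf (network p \<theta>) (gibbs1 p \<theta>) = network p \<theta>"
proof -
  have "bind_pmf (network p \<theta>)
      (\<lambda>x. foldl (\<lambda>M i. bind_pmf M (gibbs_update p \<theta> i)) (return_pmf x) [0..<n]) = network p \<theta>"
    if "n \<le> p" for n
    using that
  proof (induction n)
    case (Suc n)
    then show ?case
      by (simp add: network_bind_gibbs_update flip: bind_assoc_pmf)
  qed (simp add: bind_return_pmf')
  then show ?thesis by (simp add: gibbs1_def[abs_def])
qed

lemma network_bind_gibbs: "bind_pmf (network p \<theta>) (gibbs p \<theta> \<tau>) = network p \<theta>"
proof (induction \<tau>)
  case (Suc \<tau>)
  then show ?case
    by (simp add: gibbs_def[abs_def] network_bind_gibbs1 flip: bind_assoc_pmf)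
qed (simp add: gibbs_def[abs_def] bind_return_pmf')

lemma coord_lipschitz_diff_le:
  assumes f: "coord_lipschitz p c f" and x: "x \<in> states p" and y: "y \<in> states p"
  shows "\<bar>f x - f y\<bar> \<le> (\<Sum>j<p. c j)"
proof -
  \<comment> \<open>A path from \<open>y\<close> to \<open>x\<close> that replaces one coordinate at
    a time.\<close>
  define z where "z n = (\<lambda>k. if k < n then x k else y k)" for n
  have z: "z n \<in> states p" for n
    using x y by (auto simp: z_def states_def PiE_iff extensional_def)
  have step: "\<bar>f (z n) - f y\<bar> \<le> (\<Sum>j<n. c j)" if "n \<le> p" for n
    using that
  proof (induction n)
    case 0
    then show ?case by (simp add: z_def)
  next
    case (Suc n)
    have "z (Suc n) = (z n)(n := x n)"
      by (auto simp: z_def fun_eq_iff)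
    then have "\<bar>f (z (Suc n)) - f (z n)\<bar> \<le> c n"
      using coord_lipschitzD[OF f z, of n "x n" n]
        states_val[OF x, of n] Suc.prems by simp
    with Suc show ?case by simp
  qed
  \<comment> \<open>Members of \<open>states p\<close> are extensional, so the path ends exactly at
    \<open>x\<close>.\<close>
  have "x k = y k" if "\<not> k < p" for k
    using PiE_arb[OF x[unfolded states_def], of k] PiE_arb[OF y[unfolded states_def], of k] that by simp
  then have "z p = x" by (auto simp: z_def)
  with step[of p] show ?thesis by simp
qed

text \<open>By stationarity the network average of \<open>h\<close> is that of \<open>f\<close>, so
  the bias is an average of differences \<open>h x0 - h y\<close>. Unit constants turn the sum of
  the propagated constants into the entry sum.\<close>

lemma gibbs_bias_le:
  assumes x0: "x0 \<in> states p" and f: "coord_lipschitz p (\<lambda>_. 1) f"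
  shows "\<bar>measure_pmf.expectation (gibbs p \<theta> \<tau> x0) f - measure_pmf.expectation (network p \<theta>) f\<bar>
    \<le> entry_sum (B_mat p \<theta> ^\<^sub>m \<tau>)"
proof -
  let ?M = "B_mat p \<theta> ^\<^sub>m \<tau>"
  define h where "h x = measure_pmf.expectation (gibbs p \<theta> \<tau> x) f" for x
  note dom = dominated_gibbs[of p \<theta> \<tau>]
  have lip: "coord_lipschitz p (\<lambda>j. \<Sum>k<p. 1 * ?M $$ (k, j)) h"
    unfolding h_def using f by (intro dominatedD(4)[OF dom]) auto
  have G: "(\<Sum>j<p. \<Sum>k<p. 1 * ?M $$ (k, j)) = entry_sum ?M"
    unfolding entry_sum_def carrier_matD[OF dominatedD(1)[OF dom]] by (subst sum.swap) simp
  have ih: "integrable (network p \<theta>) h"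
    by (intro integrable_measure_pmf_finite) (simp add: set_network)
  have "measure_pmf.expectation (network p \<theta>) f
      = measure_pmf.expectation (bind_pmf (network p \<theta>) (gibbs p \<theta> \<tau>)) f"
    by (simp add: network_bind_gibbs)
  also have "\<dots> = measure_pmf.expectation (network p \<theta>) h"
    unfolding h_def by (rule expectation_bind_states[of _ p]) (simp_all add: set_network dominatedD(3)[OF dom])
  finally have "h x0 - measure_pmf.expectation (network p \<theta>) f
      = measure_pmf.expectation (network p \<theta>) (\<lambda>y. h x0 - h y)"
    using ih by simp
  also have "\<bar>\<dots>\<bar> \<le> measure_pmf.expectation (network p \<theta>) (\<lambda>y. \<bar>h x0 - h y\<bar>)"
    by (rule integral_abs_bound)
  also have "\<dots> \<le> entry_sum ?M"
    using coord_lipschitz_diff_le[OF lip x0, unfolded G] ih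
    by (intro measure_pmf.integral_le_const) (auto simp: AE_measure_pmf_iff set_network)
  finally show ?thesis by (simp add: h_def)
qed

subsection \<open>The gradient error\<close>

lemma psi_01: "e \<in> param_index p \<Longrightarrow> x \<in> states p \<Longrightarrow> psi e x \<in> {0, 1}"
  using states_val[of x p "fst e"] states_val[of x p "snd e"]
  by (auto simp: param_index_def psi_def)

lemma coord_lipschitz_psi:
  assumes "e \<in> param_index p"
  shows "coord_lipschitz p (\<lambda>_. 1) (psi e)"
  unfolding coord_lipschitz_def
proof (intro ballI allI impI)
  fix x j and v :: real assume x: "x \<in> states p" and j: "j < p" and v: "v \<in> {0, 1}"
  show "\<bar>psi e (x(j := v)) - psi e x\<bar> \<le> 1"
    using psi_01[OF assms x] psi_01[OF assms states_upd[OF x j v]] by auto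
qed

lemma entry_sum_pow_B_mat_nonneg: "0 \<le> entry_sum (B_mat p \<theta> ^\<^sub>m \<tau>)"
  unfolding entry_sum_def carrier_matD[OF dominatedD(1)[OF dominated_gibbs]]
  by (intro sum_nonneg dominatedD(2)[OF dominated_gibbs]) auto

text \<open>For 0-1 values the unbiased sample variance is exactly \<open>q / (q - 1)\<close> times
  \<open>m * (1 - m)\<close>.\<close>

lemma sample_var_01_ge:
  assumes q: "2 \<le> q" and psi: "\<And>k. k < q \<Longrightarrow> psi e (xs k) \<in> {0, 1}"
  defines "m \<equiv> sample_mean q xs e"
  shows "0 \<le> m" "m \<le> 1" "m * (1 - m) \<le> sample_var q xs e"
proof -
  have S: "(\<Sum>k<q. psi e (xs k)) = real q * m"
    using q by (simp add: m_def sample_mean_def)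
  have sq: "(psi e (xs k) - m)\<^sup>2 = (1 - 2 * m) * psi e (xs k) + m\<^sup>2" if "k < q" for k
    using psi[OF that] by (auto simp: power2_eq_square algebra_simps)
  have "(\<Sum>k<q. psi e (xs k)) \<le> (\<Sum>k<q. 1)"
    using psi by (intro sum_mono) force
  then have "real q * m \<le> real q * 1" unfolding S by simp
  then show m1: "m \<le> 1" using q by simp
  have "0 \<le> (\<Sum>k<q. psi e (xs k))"
    using psi by (intro sum_nonneg) force
  then show m0: "0 \<le> m" using q unfolding S by (simp add: zero_le_mult_iff)
  have "(\<Sum>k<q. (psi e (xs k) - m)\<^sup>2) = (1 - 2 * m) * (\<Sum>k<q. psi e (xs k)) + real q * m\<^sup>2"
    by (simp add: sq sum.distrib sum_distrib_left)
  also have "\<dots> = real q * (m * (1 - m))"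
    unfolding S by (simp add: power2_eq_square algebra_simps)
  finally have "sample_var q xs e = real q * (m * (1 - m)) / (real q - 1)"
    by (simp add: sample_var_def m_def)
  moreover have "(real q - 1) * (m * (1 - m)) \<le> real q * (m * (1 - m))"
    using m0 m1 by (intro mult_right_mono) auto
  ultimately show "m * (1 - m) \<le> sample_var q xs e"
    using q by (simp add: pos_le_divide_eq mult.commute)
qed

text \<open>Translates the radius for \<open>t = L / q\<close> into the shape of
  \<open>\<epsilon>\<close>. \<open>L\<close> and \<open>L'\<close> stand for the logarithms at
  \<open>b\<close> and at the smaller \<open>\<beta>\<close>.\<close>

lemma empirical_radius_ge:
  fixes q :: nat and V L L' :: real
  assumes q: "2 \<le> q" and V: "0 \<le> V" and L: "0 \<le> L" "L \<le> L'"
  shows "sqrt (2 * V * (L / real q)) + 14 / 3 * (L / real q)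
    \<le> 2 * (sqrt (V * L' / (2 * real q)) + 7 * L' / (3 * (real q - 1)))"
proof -
  have "sqrt (2 * V * (L / real q)) = sqrt (2\<^sup>2 * (V * L / (2 * real q)))"
    by (simp add: power2_eq_square field_simps)
  also have "\<dots> = 2 * sqrt (V * L / (2 * real q))"
    by (simp only: real_sqrt_mult real_sqrt_abs abs_numeral)
  also have "\<dots> \<le> 2 * sqrt (V * L' / (2 * real q))"
    using V L q by (simp add: divide_right_mono mult_left_mono)
  finally have 1: "sqrt (2 * V * (L / real q)) \<le> 2 * sqrt (V * L' / (2 * real q))" .
  have "L / real q \<le> L' / (real q - 1)"
    using L q by (intro frac_le) auto
  then have "14 / 3 * (L / real q) \<le> 14 / 3 * (L' / (real q - 1))"
    by (intro mult_left_mono) auto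
  also have "\<dots> = 2 * (7 * L' / (3 * (real q - 1)))" by simp
  finally show ?thesis using 1 by simp
qed

text \<open>The data mean cancels. Minkowski's inequality separates sampling noise from bias, and
  the bias is bounded uniformly over the components.\<close>

lemma L2_grad_error_le:
  assumes p: "1 \<le> p" and x0: "x0 \<in> states p" and eps: "\<And>e. e \<in> param_index p \<Longrightarrow>
      \<bar>sample_mean q xs e - measure_pmf.expectation (gibbs p \<theta> \<tau> x0) (psi e)\<bar> \<le> eps e"
  shows "L2_set (grad_error p q X \<theta> xs) (param_index p)
    \<le> 2 * sqrt (real (num_params p)) * (entry_sum (B_mat p \<theta> ^\<^sub>m \<tau>)
        + sqrt ((\<Sum>e\<in>param_index p. (eps e)\<^sup>2) / (4 * real (num_params p))))"
proof -
  let ?I = "param_index p" and ?G = "entry_sum (B_mat p \<theta> ^\<^sub>m \<tau>)" and ?m = "real (num_params p)"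
  have G: "0 \<le> ?G" by (rule entry_sum_pow_B_mat_nonneg)
  have "(0, 0) \<in> ?I" using p by (simp add: param_index_def)
  then have m: "0 < ?m" unfolding num_params_def by (auto simp: card_gt_0_iff)
  define u where "u e = sample_mean q xs e - measure_pmf.expectation (gibbs p \<theta> \<tau> x0) (psi e)" for e
  define w where "w e = measure_pmf.expectation (gibbs p \<theta> \<tau> x0) (psi e)
      - measure_pmf.expectation (network p \<theta>) (psi e)" for e
  have "L2_set (grad_error p q X \<theta> xs) ?I = L2_set (\<lambda>e. u e + w e) ?I"
    by (intro L2_set_cong) (simp_all add: grad_error_def approx_grad_def grad_eq u_def w_def)
  also have "\<dots> \<le> L2_set u ?I + L2_set w ?I" by (rule L2_set_triangle_ineq)
  also have "L2_set u ?I \<le> L2_set eps ?I"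
  proof -
    have "L2_set u ?I = L2_set (\<lambda>e. \<bar>u e\<bar>) ?I" by (simp add: L2_set_def)
    also have "\<dots> \<le> L2_set eps ?I" using eps by (intro L2_set_mono) (auto simp: u_def)
    finally show ?thesis .
  qed
  also have "L2_set w ?I \<le> sqrt ?m * ?G"
  proof -
    have "L2_set w ?I = L2_set (\<lambda>e. \<bar>w e\<bar>) ?I" by (simp add: L2_set_def)
    also have "\<dots> \<le> L2_set (\<lambda>_. ?G) ?I"
      using gibbs_bias_le[OF x0 coord_lipschitz_psi] by (intro L2_set_mono) (auto simp: w_def)
    also have "\<dots> = sqrt ?m * ?G" using G by (simp add: L2_set_constant num_params_def)
    finally show ?thesis .
  qed
  \<comment> \<open>The bias term is doubled to match the common factor \<open>2 * sqrt ?m\<close>;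
    the 4 under the root compensates that factor in the noise term.\<close>
  also have "L2_set eps ?I + sqrt ?m * ?G \<le> sqrt (\<Sum>e\<in>?I. (eps e)\<^sup>2) + 2 * sqrt ?m * ?G"
    using G by (simp add: L2_set_def)
  also have "sqrt (\<Sum>e\<in>?I. (eps e)\<^sup>2) = 2 * sqrt ?m * sqrt ((\<Sum>e\<in>?I. (eps e)\<^sup>2) / (4 * ?m))"
    using m by (simp add: real_sqrt_divide real_sqrt_mult)
  finally show ?thesis by (simp add: algebra_simps)
qed

text \<open>\<open>\<epsilon>\<close> and \<open>\<beta>\<close> depend on the outcome because the
  equation linking them contains the sample variance. The deterministic levels \<open>b\<close> make
  the probability bound meaningful; with \<open>\<beta> xs = b\<close> for all \<open>xs\<close> the
  premise inside the event always holds.\<close>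

theorem theorem4:
  fixes p q \<tau> :: nat and \<theta> :: params and x0 :: state and X :: "state list"
    and \<epsilon> \<beta> :: "(nat \<Rightarrow> state) \<Rightarrow> nat \<times> nat \<Rightarrow> real"
    and b :: "nat \<times> nat \<Rightarrow> real"
  assumes "p \<ge> 1" and "q \<ge> 2"
    and "x0 \<in> states p"
    and "X \<noteq> []" and "set X \<subseteq> states p"
    and "\<And>xs e. e \<in> param_index p \<Longrightarrow> \<epsilon> xs e > 0"
    and "\<And>xs e. e \<in> param_index p \<Longrightarrow> \<beta> xs e > 0"
    and "\<And>xs e. e \<in> param_index p \<Longrightarrow>
           \<epsilon> xs e = 2 * (sqrt (sample_var q xs e * ln (2 / \<beta> xs e) / (2 * real q))
                          + 7 * ln (2 / \<beta> xs e) / (3 * (real q - 1)))"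
    and "\<And>e. e \<in> param_index p \<Longrightarrow> b e > 0"
  shows "measure_pmf.prob (gibbs_trials p \<theta> q \<tau> x0)
           {xs. (\<forall>e\<in>param_index p. \<beta> xs e \<le> b e) \<longrightarrow>
                L2_set (grad_error p q X \<theta> xs) (param_index p)
                  \<le> 2 * sqrt (real (num_params p)) *
                     (entry_sum (B_mat p \<theta> ^\<^sub>m \<tau>)
                      + sqrt ((\<Sum>e\<in>param_index p. (\<epsilon> xs e)\<^sup>2) / (4 * real (num_params p))))}
         \<ge> 1 - 2 * (\<Sum>e\<in>param_index p. b e)"
    (is "measure_pmf.prob ?P ?T \<ge> _")
proof (cases "2 * (\<Sum>e\<in>param_index p. b e) \<ge> 1")
  \<comment> \<open>Here the claimed lower bound is at most 0. In the other case every
    \<open>b e\<close> is below 1, which makes the logarithms positive.\<close>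
  case True
  then show ?thesis using measure_nonneg[of ?P ?T] by linarith
next
  case False
  let ?I = "param_index p" and ?G = "gibbs p \<theta> \<tau> x0"
  define \<mu> where "\<mu> e = measure_pmf.expectation ?G (psi e)" for e
  \<comment> \<open>Chosen so that \<open>2 * exp (- real q * t e) = b e\<close>. The events
    \<open>Bad e\<close> below involve only deterministic thresholds, so a union bound applies
    although \<open>\<epsilon>\<close> is random.\<close>
  define t where "t e = ln (2 / b e) / real q" for e
  define Bad where "Bad e = {xs. sqrt (2 * (\<mu> e * (1 - \<mu> e)) * t e) + t e
      \<le> \<bar>(\<Sum>k<q. psi e (xs k)) / real q - \<mu> e\<bar>}" for e
  have q: "0 < q" using \<open>q \<ge> 2\<close> by simp
  have b: "0 < b e" "b e < 1" if e: "e \<in> ?I" for e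
  proof -
    show "0 < b e" using assms(9)[OF e] .
    have "b e \<le> (\<Sum>e\<in>?I. b e)"
      using e assms(9) by (intro member_le_sum) (auto intro: less_imp_le)
    then show "b e < 1" using False by simp
  qed
  have L: "0 < ln (2 / b e)" if "e \<in> ?I" for e
    using b[OF that] by (intro ln_gt_zero) simp
  have t: "0 < t e" if "e \<in> ?I" for e
    using L[OF that] q by (simp add: t_def)
  have sG: "set_pmf ?G \<subseteq> states p"
    using dominatedD(3)[OF dominated_gibbs \<open>x0 \<in> states p\<close>] .
  have psi: "psi e x \<in> {0, 1}" if "e \<in> ?I" "x \<in> set_pmf ?G" for e x
    using psi_01[OF that(1)] sG that(2) by blast
  have mu: "0 \<le> \<mu> e" "\<mu> e \<le> 1" if e: "e \<in> ?I" for e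
  proof -
    have bd: "0 \<le> psi e x" "psi e x \<le> 1" if "x \<in> set_pmf ?G" for x
      using psi[OF e that] by auto
    show "0 \<le> \<mu> e"
      unfolding \<mu>_def by (intro integral_nonneg_AE) (simp add: AE_measure_pmf_iff bd)
    show "\<mu> e \<le> 1"
      unfolding \<mu>_def using finite_subset[OF sG finite_states] bd
      by (intro measure_pmf.integral_le_const integrable_measure_pmf_finite)
         (simp_all add: AE_measure_pmf_iff)
  qed
  have bad: "measure_pmf.prob ?P (Bad e) \<le> b e" if e: "e \<in> ?I" for e
  proof -
    have "measure_pmf.prob ?P (Bad e) \<le> 2 * exp (- real q * t e)"
      unfolding Bad_def gibbs_trials_def \<mu>_def
      by (intro bernstein_01_Pi_pmf psi e t q)
    also have "- real q * t e = - ln (2 / b e)" using q by (simp add: t_def)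
    also have "2 * exp (- ln (2 / b e)) = b e" using b[OF e] by (simp add: exp_minus)
    finally show ?thesis .
  qed
  have good: "xs \<in> ?T" if xs: "xs \<in> set_pmf ?P" and nb: "\<forall>e\<in>?I. xs \<notin> Bad e" for xs
  proof (rule CollectI, rule impI, rule L2_grad_error_le[OF \<open>p \<ge> 1\<close> \<open>x0 \<in> states p\<close>])
    fix e assume le: "\<forall>e\<in>?I. \<beta> xs e \<le> b e" and e: "e \<in> ?I"
    have xsk: "psi e (xs k) \<in> {0, 1}" if "k < q" for k
      using xs that psi[OF e] by (auto simp: gibbs_trials_def set_Pi_pmf PiE_dflt_def)
    note sv = sample_var_01_ge[of q e xs, OF \<open>q \<ge> 2\<close> xsk]
    have V: "0 \<le> sample_var q xs e"
      using sv mult_nonneg_nonneg[of "sample_mean q xs e" "1 - sample_mean q xs e"] by linarith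
    \<comment> \<open>A smaller level \<open>\<beta>\<close> only enlarges the radius, so the
      threshold at level \<open>b\<close> stays below \<open>\<epsilon>\<close>.\<close>
    have "ln (2 / b e) \<le> ln (2 / \<beta> xs e)"
      using le e b[OF e] assms(7)[OF e, of xs] by (subst ln_le_cancel_iff) (auto intro!: divide_left_mono)
    then have "sqrt (2 * sample_var q xs e * t e) + 14 / 3 * t e \<le> \<epsilon> xs e"
      using empirical_radius_ge[OF \<open>q \<ge> 2\<close> V] L[OF e] assms(8)[OF e, of xs]
      by (simp add: t_def)
    moreover have "\<not> sqrt (2 * (\<mu> e * (1 - \<mu> e)) * t e) + t e \<le> \<bar>sample_mean q xs e - \<mu> e\<bar>"
      using nb e by (simp add: Bad_def sample_mean_def)
    ultimately have "\<bar>sample_mean q xs e - \<mu> e\<bar> \<le> \<epsilon> xs e"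
      using empirical_threshold_le[OF sv(1,2) mu[OF e] t[OF e] sv(3)] by fastforce
    then show "\<bar>sample_mean q xs e - measure_pmf.expectation ?G (psi e)\<bar> \<le> \<epsilon> xs e"
      by (simp add: \<mu>_def)
  qed
  have "measure_pmf.prob ?P (?T \<union> (\<Union>e\<in>?I. Bad e)) = 1"
  proof (subst measure_pmf.prob_eq_1)
    show "AE xs in measure_pmf ?P. xs \<in> ?T \<union> (\<Union>e\<in>?I. Bad e)"
      unfolding AE_measure_pmf_iff using good by blast
  qed simp
  then have "1 = measure_pmf.prob ?P (?T \<union> (\<Union>e\<in>?I. Bad e))" by (rule sym)
  also have "\<dots> \<le> measure_pmf.prob ?P ?T + measure_pmf.prob ?P (\<Union>e\<in>?I. Bad e)"
    by (intro measure_subadditive) auto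
  also have "measure_pmf.prob ?P (\<Union>e\<in>?I. Bad e) \<le> (\<Sum>e\<in>?I. measure_pmf.prob ?P (Bad e))"
    by (intro measure_pmf.finite_measure_subadditive_finite) auto
  also have "\<dots> \<le> (\<Sum>e\<in>?I. b e)" by (intro sum_mono bad)
  also have "\<dots> \<le> 2 * (\<Sum>e\<in>?I. b e)"
    using assms(9) by (simp add: sum_nonneg less_imp_le)
  finally show ?thesis by simp
qed

end
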